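(* Let $k$ be an algebraically closed subfield of $\mathbb C$. There exists a $\le_p$-chain of unbounded and counbounded subsets of $k$ that has order type $\zeta$; that is, there exists a family $(A_m)_{m\in\mathbb Z}$ of subsets of $k$ such that every $A_m$ and every $k\setminus A_m$ is unbounded and, for all $m,m'\in\mathbb Z$, $m<m'$ if and only if $A_m<_p A_{m'}$.
   Context: For $A,B\subseteq k$, $A\le_p B$ means that there is a polynomial $P\in k[X]$ with $A=P^{-1}(B)$ (preimage under $P:k\to k$); $A<_p B$ means $A\le_p B$ and not $B\le_p A$. Boundedness refers to the Euclidean metric of $\mathbb C$; a subset of $k$ is counbounded if its complement in $k$ is unbounded. $\zeta$ is the order type of the integers. *)

theory Defs
  imports "HOL-Analysis.Analysis" "HOL-Computational_Algebra.Polynomial"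
begin

definition complex_subfield :: "complex set \<Rightarrow> bool" where
  "complex_subfield k \<longleftrightarrow>
     0 \<in> k \<and> 1 \<in> k \<and>
     (\<forall>x\<in>k. \<forall>y\<in>k. x + y \<in> k \<and> x * y \<in> k) \<and>
     (\<forall>x\<in>k. - x \<in> k \<and> inverse x \<in> k)"

text \<open>
  Polynomials over \<open>k\<close> are the complex polynomials all of whose coefficients lie in \<open>k\<close>.
\<close>

definition polys_over :: "complex set \<Rightarrow> complex poly set" where
  "polys_over k = {P. \<forall>i. coeff P i \<in> k}"

definition algebraically_closed_subfield :: "complex set \<Rightarrow> bool" where
  "algebraically_closed_subfield k \<longleftrightarrow>
     complex_subfield k \<and>
     (\<forall>P\<in>polys_over k. degree P > 0 \<longrightarrow> (\<exists>z\<in>k. poly P z = 0))"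

text \<open>
  The preimage is taken under the polynomial function from \<open>k\<close> to \<open>k\<close>, hence the
  intersection with \<open>k\<close>. Constant polynomials are allowed.
\<close>

definition poly_le :: "complex set \<Rightarrow> complex set \<Rightarrow> complex set \<Rightarrow> bool" where
  "poly_le k A B \<longleftrightarrow> (\<exists>P\<in>polys_over k. A = poly P -` B \<inter> k)"

definition poly_less :: "complex set \<Rightarrow> complex set \<Rightarrow> complex set \<Rightarrow> bool" where
  "poly_less k A B \<longleftrightarrow> poly_le k A B \<and> \<not> poly_le k B A"

definition counbounded :: "complex set \<Rightarrow> complex set \<Rightarrow> bool" where
  "counbounded k A \<longleftrightarrow> \<not> bounded (k - A)"

end

theory Submission
  imports Defs
begin

text \<open>
  In the logarithmic coordinate \<open>u = ln (norm z)\<close> a polynomial of degree \<open>d \<ge> 1\<close> acts near infinity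
  as the affine map \<open>u \<mapsto> d * u + c\<close> up to a vanishing error, and the monomial of degree
  \<open>d\<close> acts exactly as \<open>u \<mapsto> d * u\<close>. Hence the sets to consider are unions of annuli in which \<open>u\<close>
  runs over alternate intervals of a fixed length \<open>T\<close>, the set \<open>log_annuli k T\<close> below.

  Pulling back under the \<open>n\<close>-th power map divides the interval length by \<open>n\<close>, so the set with
  length \<open>T\<close> reduces to the one with length \<open>n * T\<close> (\<open>poly_le_log_annuli_mult\<close>). No polynomial
  reduces a coarse set to a fine one: if \<open>S \<ge> 2 * T\<close>, then an interval of length \<open>S\<close> that
  belongs to the coarse set is stretched to one of length about \<open>d * S \<ge> 2 * T\<close>. It cannot stay
  inside a single interval of length \<open>T\<close>, and it leaves by a margin that the vanishing error does
  not consume (\<open>not_poly_le_log_annuli_coarse\<close>). The lengths \<open>2 powi m\<close> for integers \<open>m\<close> therefore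
  give a chain without endpoints.

  All sample points are positive rationals, which lie in every subfield of the complex numbers and
  have dense logarithms.
\<close>

section \<open>Alternating logarithmic annuli\<close>

text \<open>
  The origin lies in every such set because \<open>ln 0 = 0\<close>. This is harmless, since monomials of positive
  degree fix the origin and all other arguments take place near infinity.
\<close>

definition log_annuli :: "complex set \<Rightarrow> real \<Rightarrow> complex set" where
  "log_annuli k T = {z \<in> k. even \<lfloor>ln (norm z) / T\<rfloor>}"

lemma complex_subfield_of_nat:
  assumes "complex_subfield k"
  shows "of_nat n \<in> k"
  using assms by (induction n) (auto simp: complex_subfield_def)

lemma complex_subfield_of_rat_pos:
  assumes "complex_subfield k" "r \<in> \<rat>" "r > 0"
  shows "complex_of_real r \<in> k"
proof -
  obtain a b :: nat where "b \<noteq> 0" and r: "\<bar>r\<bar> = real a / real b"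
    using Rats_abs_nat_div_natE[OF assms(2)] by metis
  have "complex_of_real r = of_nat a * inverse (of_nat b)"
    using r assms(3) by (simp add: field_simps)
  then show ?thesis
    using assms(1) complex_subfield_of_nat[OF assms(1)] by (simp add: complex_subfield_def)
qed

lemma complex_subfield_log_dense:
  assumes "complex_subfield k" "T > 0" "a < b"
  obtains z where "z \<in> k" "z \<noteq> 0" "a < ln (norm z) / T" "ln (norm z) / T < b"
proof -
  have "exp (T * a) < exp (T * b)" using assms by simp
  then obtain r where r: "r \<in> \<rat>" "exp (T * a) < r" "r < exp (T * b)"
    using Rats_dense_in_real by blast
  have pos: "r > 0" using r(2) exp_gt_zero[of "T * a"] by linarith
  have "T * a < ln r" "ln r < T * b"
    using r pos by (metis exp_less_cancel_iff exp_ln)+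
  then have "a < ln r / T" "ln r / T < b"
    using assms(2) by (simp_all add: field_simps)
  then show ?thesis
    using that[of "of_real r"] complex_subfield_of_rat_pos[OF assms(1) r(1) pos] pos by simp
qed

lemma unbounded_if_log_arbitrarily_large:
  fixes A :: "complex set"
  assumes "T > 0" "\<And>N. \<exists>z\<in>A. z \<noteq> 0 \<and> N < ln (norm z) / T"
  shows "\<not> bounded A"
proof
  assume "bounded A"
  then obtain B where B: "B > 0" "\<And>z. z \<in> A \<Longrightarrow> norm z \<le> B"
    by (auto simp: bounded_pos)
  obtain z where z: "z \<in> A" "z \<noteq> 0" "ln B / T < ln (norm z) / T"
    using assms(2) by blast
  have "ln B < ln (norm z)" using z(3) assms(1) by (simp add: divide_less_cancel)
  then have "B < norm z" using z(2) B(1) by simp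
  then show False using B(2)[OF z(1)] by simp
qed

lemma log_annuli_unbounded_counbounded:
  assumes "complex_subfield k" "T > 0"
  shows "\<not> bounded (log_annuli k T)" "counbounded k (log_annuli k T)"
proof -
  have cell: "\<exists>z\<in>k. z \<noteq> 0 \<and> N < ln (norm z) / T \<and> (even \<lfloor>ln (norm z) / T\<rfloor> \<longleftrightarrow> even i)"
    for N :: real and i :: int
  proof -
    define j where "j = 2 * \<bar>\<lceil>N\<rceil>\<bar> + \<bar>i\<bar>"
    have j: "N \<le> real_of_int j" "even j \<longleftrightarrow> even i" unfolding j_def by linarith simp
    obtain z where z: "z \<in> k" "z \<noteq> 0" "j < ln (norm z) / T" "ln (norm z) / T < j + 1"
      using complex_subfield_log_dense[OF assms, of j "j + 1"] by auto
    have "\<lfloor>ln (norm z) / T\<rfloor> = j" using z by linarith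
    then show ?thesis using z j by force
  qed
  show "\<not> bounded (log_annuli k T)"
  proof (rule unbounded_if_log_arbitrarily_large[OF assms(2)])
    show "\<exists>z\<in>log_annuli k T. z \<noteq> 0 \<and> N < ln (norm z) / T" for N
      using cell[of N 0] unfolding log_annuli_def by auto
  qed
  show "counbounded k (log_annuli k T)"
    unfolding counbounded_def
  proof (rule unbounded_if_log_arbitrarily_large[OF assms(2)])
    show "\<exists>z\<in>k - log_annuli k T. z \<noteq> 0 \<and> N < ln (norm z) / T" for N
      using cell[of N 1] unfolding log_annuli_def by auto
  qed
qed

section \<open>Monomials refine the annuli\<close>

lemma poly_le_log_annuli_mult:
  assumes "complex_subfield k" "n > 0"
  shows "poly_le k (log_annuli k T) (log_annuli k (real n * T))"
proof -
  have pow: "z ^ i \<in> k" if "z \<in> k" for z i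
    using that assms(1) by (induction i) (auto simp: complex_subfield_def)
  have "ln (norm (z ^ n)) / (real n * T) = ln (norm z) / T" for z :: complex
    using assms(2) by (cases "z = 0") (simp_all add: norm_power ln_realpow zero_power)
  then have "log_annuli k T = poly (monom 1 n) -` log_annuli k (real n * T) \<inter> k"
    using pow by (auto simp: log_annuli_def poly_monom)
  moreover have "monom 1 n \<in> polys_over k"
    using assms(1) by (auto simp: polys_over_def complex_subfield_def)
  ultimately show ?thesis by (auto simp: poly_le_def)
qed

section \<open>No polynomial coarsens the annuli\<close>

lemma ln_norm_poly_asymptotic:
  fixes Q :: "complex poly"
  assumes "Q \<noteq> 0"
  shows "((\<lambda>z. ln (norm (poly Q z)) - real (degree Q) * ln (norm z))
           \<longlongrightarrow> ln (norm (lead_coeff Q))) at_infinity"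
proof -
  have lim: "((\<lambda>z. poly Q z / z ^ degree Q) \<longlongrightarrow> lead_coeff Q) at_infinity"
    by (rule poly_divide_tendsto_aux)
  have "((\<lambda>z. ln (norm (poly Q z / z ^ degree Q))) \<longlongrightarrow> ln (norm (lead_coeff Q))) at_infinity"
    using assms by (intro tendsto_ln tendsto_norm lim) auto
  moreover have "\<forall>\<^sub>F z in at_infinity. ln (norm (poly Q z / z ^ degree Q)) =
      ln (norm (poly Q z)) - real (degree Q) * ln (norm z)"
  proof -
    have "\<forall>\<^sub>F z in at_infinity. poly Q z / z ^ degree Q \<noteq> 0"
      using lim assms by (intro tendsto_imp_eventually_ne) auto
    moreover have "\<forall>\<^sub>F z in at_infinity. (z :: complex) \<noteq> 0"
      by (rule eventually_not_equal_at_infinity)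
    ultimately show ?thesis
      by eventually_elim (auto simp: norm_divide norm_power ln_div ln_realpow)
  qed
  ultimately show ?thesis by (rule Lim_transform_eventually)
qed

text \<open>
  This isolates the stretching argument in the coordinate \<open>v\<close> normalised so that the coarse intervals
  have length 1; \<open>h\<close> is the error of the affine approximation and \<open>e\<close> the stretching factor.
  The image of \<open>[2 * n, 2 * n + 1]\<close> under \<open>v \<mapsto> e * v + c\<close> contains an interval \<open>[a, a + 2]\<close>, hence
  the midpoint \<open>y\<close> of an odd unit interval. Moving \<open>y\<close> by a quarter towards the middle \<open>a + 1\<close> keeps it
  at distance at least a quarter from the ends of both intervals. This room makes the
  tolerances independent of \<open>N\<close>, so that \<open>N\<close> can be chosen after the error is known to be small.
\<close>

lemma affine_stretch_changes_parity:
  fixes e c N :: real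
  assumes "e \<ge> 2"
  shows "\<exists>u>N. \<forall>v h. \<bar>v - u\<bar> < 1 / (8 * e) \<longrightarrow> \<bar>h\<bar> < 1 / 8 \<longrightarrow>
           even \<lfloor>v\<rfloor> \<and> odd \<lfloor>e * v + c + h\<rfloor>"
proof -
  define n where "n = \<lceil>\<bar>N\<bar>\<rceil>"
  define a where "a = e * (2 * real_of_int n) + c"
  \<comment> \<open>\<open>j\<close> is the integer for which \<open>2 * j + 3 / 2\<close> lies in \<open>[a, a + 2)\<close>\<close>
  define j where "j = \<lceil>(a - 3 / 2) / 2\<rceil>"
  define y where "y = 2 * real_of_int j + 3 / 2"
  have "real_of_int j - 1 < (a - 3 / 2) / 2" "(a - 3 / 2) / 2 \<le> real_of_int j"
    unfolding j_def by linarith+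
  then have y: "a \<le> y" "y < a + 2" by (simp_all add: y_def)
  define y' where "y' = (if y < a + 1 then y + 1 / 4 else y - 1 / 4)"
  have y': "a + 1 / 4 \<le> y'" "y' \<le> a + 7 / 4" "\<bar>y' - y\<bar> \<le> 1 / 4"
    using y by (auto simp: y'_def)
  define u where "u = 2 * real_of_int n + (y' - a) / e"
  have eu: "e * u + c = y'"
  proof -
    have "e * ((y' - a) / e) = y' - a" using assms by simp
    then show ?thesis unfolding u_def distrib_left a_def by linarith
  qed
  have "N \<le> 2 * real_of_int n" unfolding n_def by linarith
  moreover have "(y' - a) / e > 0" using y' assms by simp
  ultimately have "u > N" by (simp add: u_def)
  moreover have "even \<lfloor>v\<rfloor> \<and> odd \<lfloor>e * v + c + h\<rfloor>"
    if v: "\<bar>v - u\<bar> < 1 / (8 * e)" and h: "\<bar>h\<bar> < 1 / 8" for v h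
  proof -
    have "e * \<bar>v - u\<bar> < 1 / 8"
      using v assms by (simp add: field_simps)
    then have ev: "\<bar>e * v - e * u\<bar> < 1 / 8"
      using assms by (simp add: abs_mult flip: right_diff_distrib)
    have "e * (2 * real_of_int n) < e * v" "e * v < e * (2 * real_of_int n + 1)"
      using ev eu y'(1,2) assms unfolding a_def distrib_left by linarith+
    then have "2 * real_of_int n < v" "v < 2 * real_of_int n + 1"
      using assms by simp_all
    then have "\<lfloor>v\<rfloor> = 2 * n" by linarith
    moreover have "\<lfloor>e * v + c + h\<rfloor> = 2 * j + 1"
      using ev eu h y'(3) unfolding y_def by linarith
    ultimately show ?thesis by simp
  qed
  ultimately show ?thesis by blast
qed

lemma not_poly_le_log_annuli_coarse:
  assumes k: "complex_subfield k" and T: "T > 0" and S: "S \<ge> 2 * T"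
  shows "\<not> poly_le k (log_annuli k S) (log_annuli k T)"
proof
  assume "poly_le k (log_annuli k S) (log_annuli k T)"
  then obtain Q where Q: "Q \<in> polys_over k" "log_annuli k S = poly Q -` log_annuli k T \<inter> k"
    by (auto simp: poly_le_def)
  have "S > 0" using S T by linarith
  note unb = log_annuli_unbounded_counbounded[OF k this]
  have deg: "degree Q > 0"
  proof (rule ccontr)
    assume "\<not> degree Q > 0"
    then obtain q where "Q = [:q:]" by (auto elim: degree_eq_zeroE)
    then have "log_annuli k S = {} \<or> log_annuli k S = k" using Q(2) by auto
    then show False using unb by (auto simp: counbounded_def)
  qed
  \<comment> \<open>the stretching factor between the two coordinates \<open>ln (norm z) / S\<close> and \<open>ln (norm w) / T\<close>\<close>
  define e where "e = real (degree Q) * (S / T)"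
  define c where "c = ln (norm (lead_coeff Q))"
  have "1 * 2 \<le> e" unfolding e_def
    using deg S T by (intro mult_mono) (auto simp: pos_le_divide_eq)
  then have e: "e \<ge> 2" by simp
  have "\<forall>\<^sub>F z in at_infinity.
      dist (ln (norm (poly Q z)) - real (degree Q) * ln (norm z)) c < T / 8"
    unfolding c_def using deg T by (intro tendstoD[OF ln_norm_poly_asymptotic]) auto
  then obtain B where B: "\<And>z. norm z \<ge> B \<Longrightarrow>
      \<bar>ln (norm (poly Q z)) - real (degree Q) * ln (norm z) - c\<bar> < T / 8"
    by (auto simp: eventually_at_infinity dist_real_def)
  \<comment> \<open>the summand 1 absorbs the distance between \<open>u\<close> and the rational approximation to it\<close>
  obtain u where u: "u > ln (max B 1) / S + 1"
    "\<And>v h. \<bar>v - u\<bar> < 1 / (8 * e) \<Longrightarrow> \<bar>h\<bar> < 1 / 8 \<Longrightarrow>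
        even \<lfloor>v\<rfloor> \<and> odd \<lfloor>e * v + c / T + h\<rfloor>"
    using affine_stretch_changes_parity[OF e] by meson
  have "1 / (8 * e) > 0" using e by simp
  then obtain z where z: "z \<in> k" "z \<noteq> 0"
      "u - 1 / (8 * e) < ln (norm z) / S" "ln (norm z) / S < u + 1 / (8 * e)"
    using complex_subfield_log_dense[OF k \<open>S > 0\<close>, of "u - 1 / (8 * e)" "u + 1 / (8 * e)"]
    by auto
  define v where "v = ln (norm z) / S"
  define h where "h = (ln (norm (poly Q z)) - real (degree Q) * ln (norm z) - c) / T"
  have v: "\<bar>v - u\<bar> < 1 / (8 * e)" using z unfolding v_def by linarith
  have "1 / (8 * e) \<le> 1" using e by (simp add: field_simps)
  then have "ln (max B 1) / S < ln (norm z) / S" using u(1) v unfolding v_def by linarith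
  then have "ln (max B 1) < ln (norm z)" using \<open>S > 0\<close> by (simp add: divide_less_cancel)
  then have "max B 1 < norm z" using z(2) by (subst (asm) ln_less_cancel_iff) auto
  then have h: "\<bar>h\<bar> < 1 / 8"
    using B[of z] T by (simp add: h_def abs_divide field_simps)
  have "e * v + c / T + h = ln (norm (poly Q z)) / T"
    using T \<open>S > 0\<close> by (simp add: e_def v_def h_def field_simps)
  then have "even \<lfloor>ln (norm z) / S\<rfloor>" "odd \<lfloor>ln (norm (poly Q z)) / T\<rfloor>"
    using u(2)[OF v h] by (simp_all add: v_def)
  then have "z \<in> log_annuli k S" "z \<notin> poly Q -` log_annuli k T"
    using z(1) by (auto simp: log_annuli_def)
  then show False using Q(2) by blast
qed

section \<open>The chain indexed by the integers\<close>

lemma poly_less_log_annuli_powi: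
  fixes m m' :: int
  assumes "complex_subfield k" "m < m'"
  shows "poly_less k (log_annuli k (2 powi m)) (log_annuli k (2 powi m'))"
proof -
  define n where "n = nat (m' - m)"
  have n: "n > 0" "m' = int n + m" using assms(2) by (auto simp: n_def)
  have eq: "2 powi m' = real (2 ^ n) * 2 powi m"
    by (simp add: n(2) power_int_add)
  have "(2 :: real) \<le> 2 ^ n" using n(1) self_le_power[of "2 :: real" n] by simp
  then have "2 * 2 powi m \<le> (2 :: real) powi m'"
    unfolding eq by (intro mult_right_mono) auto
  then have "\<not> poly_le k (log_annuli k (2 powi m')) (log_annuli k (2 powi m))"
    using assms(1) by (intro not_poly_le_log_annuli_coarse) auto
  moreover have "poly_le k (log_annuli k (2 powi m)) (log_annuli k (2 powi m'))"
    unfolding eq using assms(1) by (intro poly_le_log_annuli_mult) auto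
  ultimately show ?thesis by (simp add: poly_less_def)
qed

theorem proposition51:
  fixes k :: "complex set"
  assumes "algebraically_closed_subfield k"
  shows "\<exists>A :: int \<Rightarrow> complex set.
           (\<forall>m. A m \<subseteq> k \<and> \<not> bounded (A m) \<and> counbounded k (A m)) \<and>
           (\<forall>m m'. m < m' \<longleftrightarrow> poly_less k (A m) (A m'))"
proof -
  have k: "complex_subfield k"
    using assms by (simp add: algebraically_closed_subfield_def)
  define A :: "int \<Rightarrow> complex set" where "A m = log_annuli k (2 powi m)" for m
  have less: "poly_less k (A m) (A m')" if "m < m'" for m m'
    unfolding A_def using poly_less_log_annuli_powi[OF k that] .
  have "m < m' \<longleftrightarrow> poly_less k (A m) (A m')" for m m'
    using less[of m m'] less[of m' m] by (cases m m' rule: linorder_cases) (auto simp: poly_less_def)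
  moreover have "A m \<subseteq> k" "\<not> bounded (A m)" "counbounded k (A m)" for m
    using log_annuli_unbounded_counbounded[OF k, of "2 powi m"]
    by (auto simp: A_def log_annuli_def)
  ultimately show ?thesis by blast
qed

end
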